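(* For every non-empty, finite, simple, connected graph $G=(V,E)$, we have $pw(G) \leq mh(G) \leq pw(G)+1$, where $pw(G)$ denotes the pathwidth of $G$ and $mh(G)$ its monotone hunter number.
   Context: Hunters and Rabbit game on a graph $G=(V,E)$. A hunter strategy is a finite sequence $\mathcal{S}=(S_1,\dots,S_\ell)$ of non-empty subsets of $V$; it uses $\max_i |S_i|$ hunters. A rabbit trajectory starting from $W\subseteq V$ is a walk $(r_0,\dots,r_\ell)$ with $r_0\in W$ and $r_i\in N(r_{i-1})$ for $1\le i\le\ell$. $\mathcal{S}$ is winning with respect to $W$ if for every rabbit trajectory starting from $W$ there is $0\le j<\ell$ with $r_j\in S_{j+1}$; "winning" means winning with respect to $V$. The contaminated sets are $Z_0=W$ and, for $1\le i\le \ell$, $Z_i=\{x\in V : \exists y\in Z_{i-1}\setminus S_i,\ xy\in E\}$. A vertex $v$ is cleared at round $i$ if $v\in S_i$, or $N(v)\cap Z_{i-1}\neq\emptyset$ and $N(v)\cap Z_{i-1}\subseteq S_i$. A strategy is monotone if for every vertex $v$, whenever $v$ is cleared at some round $i$, then for every $j>i$ with $v\in Z_j$ we have $v\in S_{j+1}$. The monotone hunter number $mh_W(G)$ is the minimum $k$ such that there is a monotone winning hunter strategy with respect to $W$ using at most $k$ hunters, and $mh(G)=mh_V(G)$; for a single-vertex graph it is set to $0$. Pathwidth: a path-decomposition is a sequence of bags $(X_1,\dots,X_p)$ covering $V$, such that every edge lies in some bag, and $X_i\cap X_q\subseteq X_j$ for $i\le j\le q$; its width is $\max|X_i|-1$,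 and $pw(G)$ is the minimum width.
   Formalization: In the definition of a monotone strategy, the condition "for every j>i with v∈Z_j we have v∈S_{j+1}" is taken for every j≥i (with j<ℓ); with j>i the bound pw(G) ≤ mh(G) fails for a connected graph on 7 vertices. *)

theory Defs
  imports "Graph_Theory.Graph_Theory"
begin

text \<open>
  Simple undirected graphs are the symmetric, loop-free digraphs without parallel arcs of
  \<^locale>\<open>graph\<close>: an undirected edge is a pair of opposite arcs.
\<close>

section \<open>The Hunters and Rabbit game\<close>

definition nbrs :: "('a, 'b) pre_digraph \<Rightarrow> 'a \<Rightarrow> 'a set" where
  "nbrs G v = {u. v \<rightarrow>\<^bsub>G\<^esub> u}"

definition hunter_strategy :: "('a, 'b) pre_digraph \<Rightarrow> 'a set list \<Rightarrow> bool" where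
  "hunter_strategy G S \<longleftrightarrow> S \<noteq> [] \<and> (\<forall>X \<in> set S. X \<noteq> {} \<and> X \<subseteq> verts G)"

text \<open>Rounds are numbered from 1, list positions from 0.\<close>

definition shots :: "'a set list \<Rightarrow> nat \<Rightarrow> 'a set" where
  "shots S i = S ! (i - 1)"

definition hunters_used :: "'a set list \<Rightarrow> nat" where
  "hunters_used S = Max (card ` set S)"

definition rabbit_trajectory ::
  "('a, 'b) pre_digraph \<Rightarrow> 'a set \<Rightarrow> nat \<Rightarrow> 'a list \<Rightarrow> bool" where
  "rabbit_trajectory G W l r \<longleftrightarrow> vwalk r G \<and> vwalk_length r = l \<and> r ! 0 \<in> W"

definition winning :: "('a, 'b) pre_digraph \<Rightarrow> 'a set \<Rightarrow> 'a set list \<Rightarrow> bool" where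
  "winning G W S \<longleftrightarrow>
     (\<forall>r. rabbit_trajectory G W (length S) r \<longrightarrow> (\<exists>j < length S. r ! j \<in> shots S (j + 1)))"

text \<open>The contaminated sets \<open>Z\<^sub>i\<close>; only the values for \<open>i \<le> length S\<close> are meaningful.\<close>

primrec contaminated ::
  "('a, 'b) pre_digraph \<Rightarrow> 'a set \<Rightarrow> 'a set list \<Rightarrow> nat \<Rightarrow> 'a set" where
  "contaminated G W S 0 = W"
| "contaminated G W S (Suc i) =
     {x \<in> verts G. \<exists>y \<in> contaminated G W S i - shots S (Suc i). x \<rightarrow>\<^bsub>G\<^esub> y}"

definition cleared_at ::
  "('a, 'b) pre_digraph \<Rightarrow> 'a set \<Rightarrow> 'a set list \<Rightarrow> nat \<Rightarrow> 'a \<Rightarrow> bool" where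
  "cleared_at G W S i v \<longleftrightarrow> 1 \<le> i \<and> i \<le> length S \<and>
     (v \<in> shots S i \<or>
      (nbrs G v \<inter> contaminated G W S (i - 1) \<noteq> {} \<and>
       nbrs G v \<inter> contaminated G W S (i - 1) \<subseteq> shots S i))"

text \<open>
  A vertex cleared at round \<open>i\<close> may not escape a shot at any later round \<open>j + 1 > i\<close> at which it
  is contaminated. The first such round is \<open>i + 1\<close>, so \<open>j\<close> starts at \<open>i\<close>. With \<open>j > i\<close> instead, a
  vertex could be recontaminated immediately after having been shot, and the monotone hunter
  number could be smaller than the pathwidth: the graph on \<open>{0..6}\<close> with edges
  01, 02, 03, 04, 14, 15, 16, 25, 26, 36, 45, 46 has pathwidth 4 (contracting 03 and 25 gives a
  complete graph on five vertices), whereas the winning strategy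
  \<open>[{0,6}, {1,2,4}, {1,3,4}, {0,5,6}]\<close> with three hunters would count as monotone.

  The bound \<open>j < length S\<close> only says that round \<open>j + 1\<close> exists; for a winning strategy the
  contaminated set after the last round is empty.
\<close>

definition monotone_strategy ::
  "('a, 'b) pre_digraph \<Rightarrow> 'a set \<Rightarrow> 'a set list \<Rightarrow> bool" where
  "monotone_strategy G W S \<longleftrightarrow>
     (\<forall>v \<in> verts G. \<forall>i. cleared_at G W S i v \<longrightarrow>
        (\<forall>j. i \<le> j \<and> j < length S \<and> v \<in> contaminated G W S j \<longrightarrow> v \<in> shots S (j + 1)))"

definition monotone_hunter_number_wrt :: "('a, 'b) pre_digraph \<Rightarrow> 'a set \<Rightarrow> nat" where
  "monotone_hunter_number_wrt G W =
     (if card (verts G) = 1 then 0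
      else (LEAST k. \<exists>S. hunter_strategy G S \<and> winning G W S \<and> monotone_strategy G W S \<and>
                         hunters_used S \<le> k))"

definition monotone_hunter_number :: "('a, 'b) pre_digraph \<Rightarrow> nat" where
  "monotone_hunter_number G = monotone_hunter_number_wrt G (verts G)"

section \<open>Pathwidth\<close>

definition path_decomposition :: "('a, 'b) pre_digraph \<Rightarrow> 'a set list \<Rightarrow> bool" where
  "path_decomposition G X \<longleftrightarrow>
     \<Union> (set X) = verts G \<and>
     (\<forall>u v. u \<rightarrow>\<^bsub>G\<^esub> v \<longrightarrow> (\<exists>B \<in> set X. u \<in> B \<and> v \<in> B)) \<and>
     (\<forall>i j q. i \<le> j \<and> j \<le> q \<and> q < length X \<longrightarrow> X ! i \<inter> X ! q \<subseteq> X ! j)"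

text \<open>The truncated subtraction is harmless: a nonempty graph has a nonempty bag.\<close>

definition decomposition_width :: "'a set list \<Rightarrow> nat" where
  "decomposition_width X = Max (card ` set X) - 1"

definition pathwidth :: "('a, 'b) pre_digraph \<Rightarrow> nat" where
  "pathwidth G = (LEAST w. \<exists>X. path_decomposition G X \<and> decomposition_width X = w)"

end

theory Submission
  imports Defs
begin

text \<open>
  Upper bound: shoot the non-empty bags in order. Inductively, a vertex all of whose bags have been
  shot is never contaminated again, since its neighbours all lie in bags already shot.

  Lower bound: let \<open>t v\<close> be the first round clearing \<open>v\<close>. As \<open>v\<close> has a neighbour, up to round
  \<open>t v - 1\<close> both \<open>v\<close> and its neighbours stay contaminated, so by monotonicity a vertex \<open>u\<close> with a
  neighbour \<open>v\<close> is shot at every round \<open>r\<close> with \<open>t u < r \<le> t v\<close>. A vertex shot at its first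
  clearing round is therefore shot throughout the interval from there to the last clearing round of
  a neighbour, and is put into the bags of these rounds. A vertex not shot at round \<open>t v\<close> has all
  its neighbours in the shot of that round, hence needs only one bag; giving each such vertex its
  own copy of the bag of that round adds at most one vertex to each bag.
\<close>

section \<open>Walks and filtered lists\<close>

lemma shots_Suc [simp]: "shots S (Suc i) = S ! i"
  by (simp add: shots_def)

lemma vwalk_snoc:
  assumes "vwalk p G" "x \<in> verts G" "last p \<rightarrow>\<^bsub>G\<^esub> x"
  shows "vwalk (p @ [x]) G"
  using assms by (auto simp: vwalk_def vwalk_arcs_append)

lemma nth_vwalk_arcs:
  assumes "Suc i < length p"
  shows "(p ! i, p ! Suc i) \<in> set (vwalk_arcs p)"
  using assms
proof (induction p arbitrary: i rule: vwalk_arcs.induct)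
  case (3 x y xs)
  then show ?case by (cases i) auto
qed auto

text \<open>Filtering embeds positions in an order-preserving way, which is what the transfer of bag
  convexity needs. A kept head goes to 0 and shifts the rest by one; a dropped head only
  shifts.\<close>

lemma filter_nth_index:
  "\<exists>f. strict_mono_on {..<length (filter P xs)} f \<and>
     (\<forall>i < length (filter P xs). f i < length xs \<and> filter P xs ! i = xs ! f i)"
proof (induction xs)
  case Nil
  then show ?case by (auto simp: strict_mono_on_def)
next
  case (Cons x xs)
  then obtain f where f: "strict_mono_on {..<length (filter P xs)} f"
    "\<forall>i < length (filter P xs). f i < length xs \<and> filter P xs ! i = xs ! f i"
    by blast
  show ?case
  proof (cases "P x")
    case True
    let ?g = "\<lambda>i. case i of 0 \<Rightarrow> 0 | Suc i \<Rightarrow> Suc (f i)"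
    show ?thesis
      using f True
      by (intro exI[of _ ?g]) (auto simp: strict_mono_on_def nth_Cons split: nat.splits)
  next
    case False
    then show ?thesis
      using f by (intro exI[of _ "\<lambda>i. Suc (f i)"]) (auto simp: strict_mono_on_def)
  qed
qed

text \<open>Bags may be empty while shots may not, so empty bags are dropped before a decomposition
  is used as a strategy.\<close>

lemma path_decomposition_filter_nonempty:
  assumes "path_decomposition G X"
  shows "path_decomposition G (filter (\<lambda>B. B \<noteq> {}) X)"
proof -
  let ?Y = "filter (\<lambda>B. B \<noteq> {}) X"
  obtain f where f: "strict_mono_on {..<length ?Y} f"
    "\<forall>i < length ?Y. f i < length X \<and> ?Y ! i = X ! f i"
    using filter_nth_index by blast
  have convex: "?Y ! i \<inter> ?Y ! q \<subseteq> ?Y ! j" if "i \<le> j" "j \<le> q" "q < length ?Y" for i j q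
  proof -
    have "f i \<le> f j" "f j \<le> f q"
      using that by (simp_all add: strict_mono_on_leD[OF f(1)])
    then show ?thesis
      using assms f(2) that unfolding path_decomposition_def by simp
  qed
  moreover have "\<Union> (set ?Y) = \<Union> (set X)"
    by auto
  moreover have "\<exists>B \<in> set ?Y. u \<in> B \<and> v \<in> B" if "u \<rightarrow>\<^bsub>G\<^esub> v" for u v
  proof -
    have "\<exists>B \<in> set X. u \<in> B \<and> v \<in> B"
      using assms that by (simp add: path_decomposition_def)
    then obtain B where B: "B \<in> set X" "u \<in> B" "v \<in> B"
      by blast
    then have "B \<in> set ?Y"
      by auto
    with B show ?thesis
      by blast
  qed
  moreover have "\<Union> (set X) = verts G"
    using assms by (simp add: path_decomposition_def)
  ultimately show ?thesis
    unfolding path_decomposition_def by simp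
qed

section \<open>Contaminated sets and escaping trajectories\<close>

context graph
begin

lemma adj_sym: "u \<rightarrow>\<^bsub>G\<^esub> v \<Longrightarrow> v \<rightarrow>\<^bsub>G\<^esub> u"
  using sym_arcs by (simp add: symmetric_def symD)

text \<open>The first step of a walk from \<open>v\<close> to any other vertex gives the neighbour.
  Connectedness speaks of \<open>mk_symmetric G\<close>, which has the same reachability because the
  arcs are already symmetric.\<close>

lemma connected_imp_neighbour:
  assumes "connected G" "card (verts G) \<noteq> 1" "v \<in> verts G"
  obtains u where "v \<rightarrow>\<^bsub>G\<^esub> u"
proof -
  obtain w where w: "w \<in> verts G" "w \<noteq> v"
    using assms(2,3) by (metis is_singletonI' is_singleton_altdef empty_iff)
  have "v \<rightarrow>\<^sup>*\<^bsub>mk_symmetric G\<^esub> w"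
    using assms w by (auto simp: connected_def strongly_connected_def)
  then have "v \<rightarrow>\<^sup>* w"
    by (simp add: reachable_mk_symmetric_eq sym_arcs)
  then show ?thesis
    using w that by (metis converse_reachable_cases)
qed

lemma contaminated_subset_verts:
  "W \<subseteq> verts G \<Longrightarrow> contaminated G W S i \<subseteq> verts G"
  by (cases i) auto

lemma contaminated_nth_of_escaping:
  assumes "vwalk r G" "r ! 0 \<in> W" "\<And>j. j < i \<Longrightarrow> r ! j \<notin> S ! j" "i < length r"
  shows "r ! i \<in> contaminated G W S i"
  using assms(3,4)
proof (induction i)
  case (Suc i)
  have "r ! i \<rightarrow>\<^bsub>G\<^esub> r ! Suc i"
    using assms(1) nth_vwalk_arcs[OF Suc.prems(2)] by (auto simp: vwalk_def)
  moreover have "r ! Suc i \<in> verts G"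
    using assms(1) Suc.prems by (auto simp: vwalk_def)
  ultimately show ?case
    using Suc by (auto intro!: bexI[of _ "r ! i"] adj_sym)
qed (use assms in simp)

lemma escaping_of_contaminated:
  assumes "W \<subseteq> verts G" "x \<in> contaminated G W S i"
  shows "\<exists>r. vwalk r G \<and> length r = Suc i \<and> last r = x \<and> r ! 0 \<in> W \<and> (\<forall>j<i. r ! j \<notin> S ! j)"
  using assms(2)
proof (induction i arbitrary: x)
  case 0
  then show ?case
    using assms(1) by (intro exI[of _ "[x]"]) auto
next
  case (Suc i)
  then obtain y where y: "y \<in> contaminated G W S i" "y \<notin> S ! i" "x \<rightarrow>\<^bsub>G\<^esub> y" "x \<in> verts G"
    by auto
  then obtain r where r: "vwalk r G" "length r = Suc i" "last r = y" "r ! 0 \<in> W"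
    "\<forall>j<i. r ! j \<notin> S ! j"
    using Suc.IH by blast
  have "r ! i = y"
    using r by (metis diff_Suc_1 last_conv_nth list.size(3) nat.distinct(1))
  moreover have "vwalk (r @ [x]) G"
    using r(1,3) y(3,4) adj_sym by (intro vwalk_snoc) auto
  moreover have "(r @ [x]) ! j \<notin> S ! j" if "j < Suc i" for j
    using that r(2,5) y(2) \<open>r ! i = y\<close> by (cases "j = i") (auto simp: nth_append)
  moreover have "(r @ [x]) ! 0 \<in> W"
    using r(2,4) by (simp add: nth_append)
  ultimately show ?case
    using r(2) by (intro exI[of _ "r @ [x]"]) simp
qed

text \<open>A rabbit that survives all rounds ends in the last contaminated set, and each vertex of
  that set is the end of such a trajectory.\<close>

lemma winning_iff_contaminated_empty:
  assumes "W \<subseteq> verts G"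
  shows "winning G W S \<longleftrightarrow> contaminated G W S (length S) = {}"
proof
  assume win: "winning G W S"
  show "contaminated G W S (length S) = {}"
  proof (rule ccontr)
    assume "contaminated G W S (length S) \<noteq> {}"
    then obtain x where "x \<in> contaminated G W S (length S)"
      by blast
    then obtain r where r: "vwalk r G" "length r = Suc (length S)" "r ! 0 \<in> W"
      "\<forall>j<length S. r ! j \<notin> S ! j"
      using escaping_of_contaminated[OF assms] by metis
    then have "rabbit_trajectory G W (length S) r"
      by (simp add: rabbit_trajectory_def)
    then show False
      using win r(4) unfolding winning_def by auto
  qed
next
  assume empty: "contaminated G W S (length S) = {}"
  show "winning G W S"
    unfolding winning_def
  proof (intro allI impI, rule ccontr)
    fix r
    assume "rabbit_trajectory G W (length S) r" and esc: "\<not> (\<exists>j<length S. r ! j \<in> shots S (j + 1))"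
    then have r: "vwalk r G" "length r = Suc (length S)" "r ! 0 \<in> W"
      by (cases r; simp add: rabbit_trajectory_def vwalk_def)+
    have "r ! length S \<in> contaminated G W S (length S)"
      using r esc by (intro contaminated_nth_of_escaping) auto
    then show False
      using empty by simp
  qed
qed

section \<open>From path decompositions to monotone strategies\<close>

text \<open>The rabbit reaches \<open>x\<close> from a neighbour \<open>y\<close> that has escaped
  every bag shot so far. A bag containing both is thus still to come, and convexity between it and
  the old bag of \<open>x\<close> puts \<open>x\<close> into the very next bag.\<close>

lemma contaminated_bags:
  assumes X: "path_decomposition G X"
    and "x \<in> contaminated G (verts G) X i" "x \<in> X ! j" "j < i" "i \<le> length X"
  shows "i < length X \<and> x \<in> X ! i"
  using assms(2-)
proof (induction i arbitrary: x j)
  case (Suc i)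
  then obtain y where y: "y \<in> contaminated G (verts G) X i" "y \<notin> X ! i" "x \<rightarrow>\<^bsub>G\<^esub> y"
    by auto
  have "\<exists>B \<in> set X. x \<in> B \<and> y \<in> B"
    using X y(3) by (simp add: path_decomposition_def)
  then obtain q where q: "q < length X" "x \<in> X ! q" "y \<in> X ! q"
    by (metis in_set_conv_nth)
  \<comment> \<open>Were \<open>y\<close> in an earlier bag, the induction hypothesis would put it
    into \<open>X ! i\<close>, where it would have been shot.\<close>
  have "y \<notin> X ! j'" if "j' \<le> i" for j'
    using Suc.IH[OF y(1), of j'] y(2) that Suc.prems(4) by (cases "j' = i") auto
  then have "Suc i \<le> q"
    using q(3) not_less_eq_eq by blast
  moreover have "X ! j \<inter> X ! q \<subseteq> X ! Suc i"
    using X Suc.prems(3) \<open>Suc i \<le> q\<close> q(1) by (simp add: path_decomposition_def)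
  ultimately show ?case
    using Suc.prems(2) q(1,2) by auto
qed simp

lemma path_decomposition_winning:
  assumes "path_decomposition G X"
  shows "winning G (verts G) X"
proof -
  have "x \<notin> contaminated G (verts G) X (length X)" for x
  proof
    assume x: "x \<in> contaminated G (verts G) X (length X)"
    then have "x \<in> verts G"
      using contaminated_subset_verts[OF subset_refl] by (rule subsetD[rotated])
    then have "x \<in> \<Union> (set X)"
      using assms by (simp add: path_decomposition_def)
    then obtain j where "j < length X" "x \<in> X ! j"
      by (auto simp: in_set_conv_nth)
    then show False
      using contaminated_bags[OF assms x] by simp
  qed
  then show ?thesis
    by (auto simp: winning_iff_contaminated_empty)
qed

text \<open>A rabbit can run to and fro along an edge whose ends are never shot.\<close>

lemma contaminated_of_unshot_edge:
  assumes "u \<rightarrow>\<^bsub>G\<^esub> v" "\<And>k. k < j \<Longrightarrow> u \<notin> S ! k \<and> v \<notin> S ! k"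
  shows "u \<in> contaminated G (verts G) S j \<and> v \<in> contaminated G (verts G) S j"
  using assms(2)
proof (induction j)
  case 0
  then show ?case using assms(1) adj_in_verts by simp
next
  case (Suc j)
  then show ?case using assms(1) adj_in_verts adj_sym[OF assms(1)]
    by (auto simp: less_Suc_eq)
qed

text \<open>If \<open>v\<close> is contaminated and escapes the next shot, neither \<open>v\<close>
  nor the neighbour \<open>y\<close> it is contaminated from lies in any earlier bag. The edge
  between them has then been contaminated all along, so \<open>v\<close> cannot have been
  cleared.\<close>

lemma path_decomposition_monotone:
  assumes X: "path_decomposition G X"
  shows "monotone_strategy G (verts G) X"
  unfolding monotone_strategy_def
proof (intro ballI allI impI, elim conjE)
  fix v i j
  assume v: "v \<in> verts G" and cl: "cleared_at G (verts G) X i v"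
    and j: "i \<le> j" "j < length X" and vj: "v \<in> contaminated G (verts G) X j"
  show "v \<in> shots X (j + 1)"
  proof (rule ccontr)
    assume "v \<notin> shots X (j + 1)"
    then have vX: "v \<notin> X ! k" if "k \<le> j" for k
      using contaminated_bags[OF X vj, of k] j that by (cases "k = j") auto
    obtain i' where i': "i = Suc i'"
      using cl by (cases i) (auto simp: cleared_at_def)
    obtain j' where j': "j = Suc j'"
      using j(1) i' by (cases j) auto
    obtain y where y: "y \<in> contaminated G (verts G) X j'" "y \<notin> X ! j'" "v \<rightarrow>\<^bsub>G\<^esub> y"
      using vj j' by auto
    have yX: "y \<notin> X ! k" if "k \<le> j'" for k
      using contaminated_bags[OF X y(1), of k] y(2) j j' that by (cases "k = j'") auto
    have "y \<in> contaminated G (verts G) X i'"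
      using contaminated_of_unshot_edge[OF y(3), of i' X] vX yX i' j' j(1) by auto
    moreover have "v \<notin> X ! i'" "y \<notin> X ! i'"
      using vX yX i' j' j(1) by auto
    ultimately show False
      using cl y(3) i' by (auto simp: cleared_at_def nbrs_def)
  qed
qed

section \<open>From monotone strategies to path decompositions\<close>

text \<open>Until \<open>v\<close> is cleared, some neighbour escapes each shot and recontaminates
  \<open>v\<close>, while \<open>v\<close>, itself unshot, recontaminates all its neighbours. The
  neighbour \<open>w\<close> is what makes the set of contaminated neighbours non-empty.\<close>

lemma uncleared_contaminated:
  assumes "v \<rightarrow>\<^bsub>G\<^esub> w" "\<And>r. r \<le> i \<Longrightarrow> \<not> cleared_at G (verts G) S r v" "i \<le> length S" "j \<le> i"
  shows "insert v (nbrs G v) \<subseteq> contaminated G (verts G) S j"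
  using assms(4)
proof (induction j)
  case 0
  then show ?case
    using assms(1) adj_in_verts by (auto simp: nbrs_def)
next
  case (Suc j)
  then have IH: "insert v (nbrs G v) \<subseteq> contaminated G (verts G) S j"
    by simp
  have nc: "v \<notin> S ! j" "nbrs G v \<inter> contaminated G (verts G) S j \<noteq> {} \<Longrightarrow>
      \<not> nbrs G v \<inter> contaminated G (verts G) S j \<subseteq> S ! j"
    using assms(2)[OF Suc.prems] Suc.prems assms(3) by (auto simp: cleared_at_def)
  have "w \<in> nbrs G v \<inter> contaminated G (verts G) S j"
    using IH assms(1) by (auto simp: nbrs_def)
  then obtain y where "y \<in> nbrs G v" "y \<in> contaminated G (verts G) S j - S ! j"
    using nc(2) by auto
  then have "v \<in> contaminated G (verts G) S (Suc j)"
    using assms(1) adj_in_verts by (auto simp: nbrs_def)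
  moreover have "nbrs G v \<subseteq> contaminated G (verts G) S (Suc j)"
  proof
    fix x assume "x \<in> nbrs G v"
    then have "x \<rightarrow>\<^bsub>G\<^esub> v" "x \<in> verts G"
      using adj_sym adj_in_verts by (auto simp: nbrs_def)
    then show "x \<in> contaminated G (verts G) S (Suc j)"
      using IH nc(1) by auto
  qed
  ultimately show ?case
    by simp
qed

lemma path_decomposition_of_monotone_strategy:
  assumes S: "hunter_strategy G S" and win: "winning G (verts G) S"
    and mono: "monotone_strategy G (verts G) S"
    and nb: "\<And>v. v \<in> verts G \<Longrightarrow> \<exists>u. v \<rightarrow>\<^bsub>G\<^esub> u"
    and ne: "verts G \<noteq> {}"
  obtains X where "path_decomposition G X" "decomposition_width X \<le> hunters_used S"
proof -
  define t where "t v = (LEAST r. cleared_at G (verts G) S r v)" for v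
  define n where "n = card (verts G)"
  have n: "n > 0"
    using ne by (simp add: n_def card_gt_0_iff)
  obtain e where e: "bij_betw e (verts G) {0..<n}"
    using ex_bij_betw_finite_nat[OF finite_verts] unfolding n_def by blast
  have e_less: "e v < n" if "v \<in> verts G" for v
    using e that by (auto simp: bij_betw_def)
  \<comment> \<open>A vertex never cleared would still be contaminated after the last round.\<close>
  have "\<exists>r. cleared_at G (verts G) S r v" if v: "v \<in> verts G" for v
  proof (rule ccontr)
    assume "\<nexists>r. cleared_at G (verts G) S r v"
    then have "v \<in> contaminated G (verts G) S (length S)"
      using nb[OF v] uncleared_contaminated[of v _ "length S" S "length S"] by blast
    then show False
      using win by (simp add: winning_iff_contaminated_empty)
  qed
  then have cl: "cleared_at G (verts G) S (t v) v" if "v \<in> verts G" for v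
    using that unfolding t_def by (metis LeastI_ex)
  have t: "1 \<le> t v" "t v \<le> length S" if "v \<in> verts G" for v
    using cl[OF that] by (auto simp: cleared_at_def)
  have before: "nbrs G v \<subseteq> contaminated G (verts G) S j" if "v \<in> verts G" "j < t v" for v j
  proof -
    obtain w where "v \<rightarrow>\<^bsub>G\<^esub> w"
      using nb \<open>v \<in> verts G\<close> by blast
    then show ?thesis
      using uncleared_contaminated[of v w j S j] not_less_Least[of _ "\<lambda>r. cleared_at G (verts G) S r v"] t(2)[OF that(1)] that
      unfolding t_def[symmetric] by auto
  qed
  \<comment> \<open>Before round \<open>t v\<close> the neighbour \<open>u\<close> of
    \<open>v\<close> is still contaminated; being cleared already, it must be shot.\<close>
  have guarded: "u \<in> S ! (r - 1)" if "u \<rightarrow>\<^bsub>G\<^esub> v" "t u < r" "r \<le> t v" for u v r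
  proof -
    have uv: "u \<in> verts G" "v \<in> verts G"
      using that adj_in_verts by auto
    have less: "r - 1 < t v"
      using that by linarith
    have "u \<in> contaminated G (verts G) S (r - 1)"
      using before[OF uv(2), of "r - 1"] less adj_sym[OF that(1)] by (auto simp: nbrs_def)
    moreover have "t u \<le> r - 1" "r - 1 < length S"
      using that less t(2)[OF uv(2)] by auto
    ultimately have "u \<in> shots S (r - 1 + 1)"
      using mono cl[OF uv(1)] uv(1) unfolding monotone_strategy_def by blast
    then show ?thesis
      by simp
  qed
  have surrounded: "u \<in> S ! (t v - 1)" if "v \<rightarrow>\<^bsub>G\<^esub> u" "v \<notin> S ! (t v - 1)" for u v
  proof -
    have v: "v \<in> verts G"
      using that adj_in_verts by auto
    have "nbrs G v \<subseteq> contaminated G (verts G) S (t v - 1)"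
      using t(1)[OF v] by (intro before[OF v]) linarith
    moreover have "u \<in> nbrs G v"
      using that by (simp add: nbrs_def)
    ultimately show ?thesis
      using cl[OF v] that(2) unfolding cleared_at_def shots_def by blast
  qed
  have shot_before: "t v \<le> r" if "v \<in> S ! (r - 1)" "1 \<le> r" "r \<le> length S" for v r
  proof -
    have "cleared_at G (verts G) S r v"
      using that unfolding cleared_at_def shots_def by blast
    then show ?thesis
      unfolding t_def by (rule Least_le)
  qed
  text \<open>Bag \<open>p\<close> belongs to round \<open>p div n\<close>; copy \<open>p mod n\<close> of that round is reserved for the vertex \<open>v\<close>
    with \<open>e v = p mod n\<close>.\<close>
  define shot where "shot v \<longleftrightarrow> v \<in> S ! (t v - 1)" for v
  \<comment> \<open>The disjunct \<open>i \<le> t v\<close> keeps the interval non-empty when all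
    neighbours are cleared before \<open>v\<close>.\<close>
  define live where "live v i \<longleftrightarrow> t v \<le> i \<and> (i \<le> t v \<or> (\<exists>u. v \<rightarrow>\<^bsub>G\<^esub> u \<and> i \<le> t u))" for v i
  define Y where "Y p = {v \<in> verts G. if shot v then live v (p div n) else p = t v * n + e v}" for p
  define X where "X = map Y [0..<Suc (length S) * n]"
  have live_shot: "v \<in> S ! (i - 1)" if "shot v" "live v i" for v i
  proof (cases "i = t v")
    case False
    then show ?thesis
      using that(2) guarded[of v _ i] unfolding live_def by auto
  qed (use that(1) in \<open>simp add: shot_def\<close>)
  have Y_mem: "Y p \<in> set X" if "p div n \<le> length S" for p
  proof -
    have "p < Suc (length S) * n"
      using that n div_less_iff_less_mult[of n p "Suc (length S)"] by linarith
    then show ?thesis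
      unfolding X_def by (simp del: upt_Suc)
  qed
  \<comment> \<open>This position lies in the block of round \<open>t v\<close>, so it serves shot
    and unshot vertices alike.\<close>
  have home: "v \<in> Y (t v * n + e v)" if "v \<in> verts G" for v
    using that e_less[OF that] n by (auto simp: Y_def live_def)
  have home_mem: "Y (t v * n + e v) \<in> set X" if "v \<in> verts G" for v
    using that e_less[OF that] t(2)[OF that] n by (intro Y_mem) simp
  have edge: "\<exists>B \<in> set X. u \<in> B \<and> v \<in> B" if uv: "u \<rightarrow>\<^bsub>G\<^esub> v" and le: "t u \<le> t v" for u v
  proof -
    have V: "u \<in> verts G" "v \<in> verts G"
      using uv adj_in_verts by auto
    show ?thesis
    proof (cases "shot u")
      case True
      \<comment> \<open>\<open>u\<close> is live up to round \<open>t v\<close>, hence in every copy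
        of that round, including the one reserved for \<open>v\<close>.\<close>
      then have "u \<in> Y (t v * n + e v)"
        using uv le V e_less[OF V(2)] n by (auto simp: Y_def live_def)
      then show ?thesis
        using home home_mem V by blast
    next
      case False
      \<comment> \<open>All neighbours of \<open>u\<close> are shot at round \<open>t u\<close>; so
        \<open>v\<close> is cleared no later than \<open>u\<close>, the two times agree, and
        \<open>v\<close> lies in all copies of that round.\<close>
      then have "v \<in> S ! (t u - 1)"
        using surrounded[OF uv] by (simp add: shot_def)
      then have "t v = t u" "shot v"
        using shot_before[of v "t u"] t[OF V(1)] le by (auto simp: shot_def)
      then have "v \<in> Y (t u * n + e u)"
        using V e_less[OF V(1)] n by (auto simp: Y_def live_def)
      then show ?thesis
        using home home_mem V by blast
    qed
  qed
  have "path_decomposition G X"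
    unfolding path_decomposition_def
  proof (intro conjI allI impI, goal_cases)
    case 1
    have "B \<subseteq> verts G" if "B \<in> set X" for B
      using that by (auto simp: X_def Y_def)
    then show ?case
      using home home_mem by blast
  next
    case (2 u v)
    then show ?case
      using edge[of u v] edge[of v u] adj_sym[of u v] nat_le_linear[of "t u" "t v"] by blast
  next
    case (3 i j q)
    then have "i div n \<le> j div n" "j div n \<le> q div n"
      by (auto intro: div_le_mono)
    \<comment> \<open>A shot vertex occupies an interval of rounds, an unshot one a single
      bag.\<close>
    then have "Y i \<inter> Y q \<subseteq> Y j"
      using 3 by (auto simp: Y_def live_def split: if_splits)
    then show ?case
      using 3 by (simp add: X_def del: upt_Suc)
  qed
  moreover have "decomposition_width X \<le> hunters_used S"
  proof -
    have "card (Y p) \<le> Suc (hunters_used S)" if "p < Suc (length S) * n" for p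
    proof (cases "p div n = 0")
      \<comment> \<open>No vertex is cleared at round 0, so the first \<open>n\<close> bags are
        empty. They are split off because \<open>p div n - 1\<close> truncates there.\<close>
      case True
      have "Y p = {}"
      proof (rule equals0I)
        fix v assume "v \<in> Y p"
        moreover from this have "1 \<le> t v" "e v < n"
          using t e_less by (auto simp: Y_def)
        moreover have "(t v * n + e v) div n = t v"
          using \<open>e v < n\<close> by simp
        ultimately show False
          using True by (auto simp: Y_def live_def split: if_splits)
      qed
      then show ?thesis
        by simp
    next
      case False
      let ?B = "S ! (p div n - 1)" and ?R = "{v \<in> verts G. p = t v * n + e v}"
      have "?B \<in> set S"
      proof (rule nth_mem)
        have "p div n < Suc (length S)"
          using that n by (simp only: div_less_iff_less_mult)
        then show "p div n - 1 < length S"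
          using False by linarith
      qed
      then have B: "card ?B \<le> hunters_used S" "finite ?B"
        using S finite_subset[OF _ finite_verts]
        by (simp_all add: hunters_used_def hunter_strategy_def)
      \<comment> \<open>The remainder of \<open>p\<close> modulo \<open>n\<close> determines the
        vertex for which this copy is reserved.\<close>
      have "x = y" if "x \<in> ?R" "y \<in> ?R" for x y
      proof -
        have xy: "x \<in> verts G" "y \<in> verts G" "p = t x * n + e x" "p = t y * n + e y"
          using that by auto
        have "p mod n = e x"
          unfolding xy(3) using e_less[OF xy(1)] by simp
        moreover have "p mod n = e y"
          unfolding xy(4) using e_less[OF xy(2)] by simp
        ultimately show ?thesis
          using bij_betw_imp_inj_on[OF e] xy(1,2) by (metis inj_onD)
      qed
      then have R: "card ?R \<le> 1"
        unfolding One_nat_def by (subst card_le_Suc0_iff_eq) (simp, blast)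
      \<comment> \<open>Live shot vertices belong to the round's shot; only the vertex owning this
        copy may lie outside it. The extra 1 is absorbed by the \<open>- 1\<close> in the
        width.\<close>
      have "Y p \<subseteq> ?B \<union> ?R"
      proof
        fix v assume "v \<in> Y p"
        then show "v \<in> ?B \<union> ?R"
          using live_shot[of v "p div n"] by (cases "shot v") (auto simp: Y_def)
      qed
      then have "card (Y p) \<le> card (?B \<union> ?R)"
        using B finite_verts by (intro card_mono) auto
      also have "\<dots> \<le> card ?B + card ?R"
        by (rule card_Un_le)
      finally show ?thesis
        using B R by simp
    qed
    moreover have "X \<noteq> []"
      using n by (simp add: X_def del: upt_Suc)
    ultimately have "Max (card ` set X) \<le> Suc (hunters_used S)"
      by (subst Max_le_iff) (auto simp: X_def)
    then show ?thesis
      by (simp add: decomposition_width_def)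
  qed
  ultimately show ?thesis
    by (rule that)
qed

section \<open>Optimal decompositions and the two bounds\<close>

lemma pathwidth_le:
  assumes "path_decomposition G X"
  shows "pathwidth G \<le> decomposition_width X"
  unfolding pathwidth_def by (rule Least_le) (use assms in blast)

text \<open>The one-bag decomposition shows that the minimum defining \<open>pathwidth\<close> is
  attained, and gives pathwidth 0 for a single vertex.\<close>

lemma path_decomposition_verts: "path_decomposition G [verts G]"
  using adj_in_verts by (auto simp: path_decomposition_def)

lemma optimal_path_decomposition:
  obtains X where "path_decomposition G X" "decomposition_width X = pathwidth G"
proof -
  have "\<exists>X. path_decomposition G X \<and> decomposition_width X = pathwidth G"
    unfolding pathwidth_def
    by (rule LeastI[where k = "decomposition_width [verts G]"])
      (use path_decomposition_verts in blast)
  then show ?thesis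
    using that by blast
qed

lemma monotone_strategy_of_path_decomposition:
  assumes "path_decomposition G X" "verts G \<noteq> {}"
  obtains S where "hunter_strategy G S" "winning G (verts G) S" "monotone_strategy G (verts G) S"
    "hunters_used S \<le> decomposition_width X + 1"
proof -
  define S where "S = filter (\<lambda>B. B \<noteq> {}) X"
  have pd: "path_decomposition G S"
    unfolding S_def by (rule path_decomposition_filter_nonempty) fact
  then have un: "\<Union> (set S) = verts G"
    by (simp add: path_decomposition_def)
  then have ne: "S \<noteq> []"
    using assms(2) by auto
  have "hunters_used S \<le> Max (card ` set X)"
    unfolding hunters_used_def
  proof (intro Max_mono image_mono)
    show "set S \<subseteq> set X"
      by (auto simp: S_def)
    show "card ` set S \<noteq> {}"
      using ne by simp
  qed simp
  moreover have "hunter_strategy G S"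
    using ne un by (auto simp: hunter_strategy_def S_def)
  ultimately show ?thesis
    using pd that path_decomposition_winning path_decomposition_monotone
    by (simp add: decomposition_width_def)
qed

end

theorem theorem3p8:
  fixes G :: "('a, 'b) pre_digraph"
  assumes "graph G"
    and "verts G \<noteq> {}"
    and "connected G"
  shows "pathwidth G \<le> monotone_hunter_number G
    \<and> monotone_hunter_number G \<le> pathwidth G + 1"
proof -
  interpret graph G by fact
  let ?P = "\<lambda>k. \<exists>S. hunter_strategy G S \<and> winning G (verts G) S \<and>
    monotone_strategy G (verts G) S \<and> hunters_used S \<le> k"
  show ?thesis
  proof (cases "card (verts G) = 1")
    \<comment> \<open>The hunter number is 0 by convention here; a single vertex has no neighbour,
      so the general argument does not apply.\<close>
    case True
    then have "pathwidth G = 0"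
      using pathwidth_le[OF path_decomposition_verts] by (simp add: decomposition_width_def)
    then show ?thesis
      using True by (simp add: monotone_hunter_number_def monotone_hunter_number_wrt_def)
  next
    case False
    then have mh: "monotone_hunter_number G = (LEAST k. ?P k)"
      by (simp add: monotone_hunter_number_def monotone_hunter_number_wrt_def)
    obtain X where X: "path_decomposition G X" "decomposition_width X = pathwidth G"
      by (rule optimal_path_decomposition)
    \<comment> \<open>Besides the upper bound, this provides the witness by which
      \<open>LEAST\<close> is attained.\<close>
    have upper: "?P (pathwidth G + 1)"
      using monotone_strategy_of_path_decomposition[OF X(1) assms(2)] X(2) by metis
    then have "?P (monotone_hunter_number G)"
      unfolding mh by (rule LeastI)
    then obtain S where S: "hunter_strategy G S" "winning G (verts G) S"
      "monotone_strategy G (verts G) S" "hunters_used S \<le> monotone_hunter_number G"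
      by blast
    have nb: "\<exists>u. v \<rightarrow>\<^bsub>G\<^esub> u" if "v \<in> verts G" for v
      using connected_imp_neighbour[OF assms(3) False that] by blast
    obtain X' where "path_decomposition G X'" "decomposition_width X' \<le> hunters_used S"
      using path_decomposition_of_monotone_strategy[OF S(1-3) nb assms(2)] by blast
    then have "pathwidth G \<le> monotone_hunter_number G"
      using pathwidth_le S(4) le_trans by blast
    moreover have "monotone_hunter_number G \<le> pathwidth G + 1"
      unfolding mh using upper by (rule Least_le)
    ultimately show ?thesis
      by simp
  qed
qed

end
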